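(* Let $X_1,X_2,\dots$ be i.i.d. $N(0,1)$-distributed random variables. (i) If $(\tau_{ij})_{i,j=1}^\infty$ is an array of centered jointly Gaussian real random variables such that for every $k\in\mathbb{N}$ $$\inf_{(a_{ij})} \mathbb{E}\Big(\tau_{kk}-\sum_{\min(i,j)<k} a_{ij}\tau_{ij}\Big)^2 = 1,$$ and if in addition the array is diagonal ($\tau_{ij}=0$ for $i\ne j$) with independent diagonal entries $\tau_{11},\tau_{22},\dots$, then the inequality $$\mathbb{P}\big(|\det(\tau_{ij})_{i,j=1}^n|\le \varepsilon\big)\le \mathbb{P}\Big(\prod_{j=1}^n |X_j|\le \varepsilon\Big)$$ holds with equality for every $n\in\mathbb{N}$ and every $\varepsilon>0$. (ii) For every fixed $n\in\mathbb{N}$, as $\varepsilon\to 0^+$, $$\mathbb{P}\Big(\prod_{j=1}^n |X_j|\le \varepsilon\Big)\sim \Big(\frac{2}{\sqrt{2\pi}}\Big)^n\,\varepsilon\,\frac{|\log\varepsilon|^{n-1}}{(n-1)!}.$$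
   Context: $\mathbb{N}=\{1,2,\dots\}$. The notation $f(\varepsilon)\sim g(\varepsilon)$ means $f(\varepsilon)/g(\varepsilon)\to 1$. In the infimum, $(a_{ij})$ ranges over real coefficient families indexed by the pairs $(i,j)$ of positive integers with $\min(i,j)<k$, with only finitely many nonzero coefficients; for $k=1$ the sum is empty. Constants (in particular $0$) count as degenerate Gaussian random variables. *)

theory Defs
  imports "HOL-Probability.Probability" "Jordan_Normal_Form.Determinant"
    "HOL-Library.Landau_Symbols"
begin

(* Gaussian in the wide sense: constants count as degenerate Gaussian variables. *)
definition gaussian_rv :: "'a measure \<Rightarrow> ('a \<Rightarrow> real) \<Rightarrow> bool" where
  "gaussian_rv M Y \<longleftrightarrow> Y \<in> borel_measurable M \<and>
     (\<exists>m. (AE \<omega> in M. Y \<omega> = m) \<or> (\<exists>s>0. distributed M lborel Y (normal_density m s)))"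

definition jointly_gaussian :: "'a measure \<Rightarrow> 'i set \<Rightarrow> ('i \<Rightarrow> 'a \<Rightarrow> real) \<Rightarrow> bool" where
  "jointly_gaussian M I Y \<longleftrightarrow>
     (\<forall>F c. finite F \<and> F \<subseteq> I \<longrightarrow> gaussian_rv M (\<lambda>\<omega>. \<Sum>i\<in>F. c i * Y i \<omega>))"

(* Arrays are indexed by positive integers; their values at index 0 are never used. *)
definition centered_gaussian_array :: "'a measure \<Rightarrow> (nat \<Rightarrow> nat \<Rightarrow> 'a \<Rightarrow> real) \<Rightarrow> bool" where
  "centered_gaussian_array M \<tau> \<longleftrightarrow>
     jointly_gaussian M ({1..} \<times> {1..}) (\<lambda>(i, j). \<tau> i j) \<and>
     (\<forall>i\<ge>1. \<forall>j\<ge>1. integral\<^sup>L M (\<tau> i j) = 0)"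

definition coeff_families :: "nat \<Rightarrow> (nat \<times> nat \<Rightarrow> real) set" where
  "coeff_families k = {a. finite {p. a p \<noteq> 0} \<and>
     {p. a p \<noteq> 0} \<subseteq> {(i, j). 1 \<le> i \<and> 1 \<le> j \<and> min i j < k}}"

definition innovation_variance :: "'a measure \<Rightarrow> (nat \<Rightarrow> nat \<Rightarrow> 'a \<Rightarrow> real) \<Rightarrow> nat \<Rightarrow> real" where
  "innovation_variance M \<tau> k =
     (INF a\<in>coeff_families k.
        integral\<^sup>L M (\<lambda>\<omega>. (\<tau> k k \<omega> - (\<Sum>(i, j) | a (i, j) \<noteq> 0. a (i, j) * \<tau> i j \<omega>))\<^sup>2))"

(* Matrices of Jordan_Normal_Form are indexed from 0, hence the shift. *)
definition corner_det :: "(nat \<Rightarrow> nat \<Rightarrow> 'a \<Rightarrow> real) \<Rightarrow> nat \<Rightarrow> 'a \<Rightarrow> real" where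
  "corner_det \<tau> n \<omega> = Determinant.det (Matrix.mat n n (\<lambda>(i, j). \<tau> (Suc i) (Suc j) \<omega>))"

end

(* The number c = 2 / sqrt (2 pi) is the supremum of the density of |X|.  Hence |X| stochastically
   dominates the uniform law on [0, 1/c], and its density is at least b = c exp (- r^2 / 2) on [0, r].
   Integrating out one factor at a time, P(|X_1| ... |X_n| <= eps) is therefore at most H_n(c^n eps)
   and at least (b r)^n H_n(eps / r^n), where H_n(t) = t (sum over k < n of ln(1/t)^k / k!) is the
   distribution function of a product of n independent uniform variables on [0, 1].  Both bounds have
   the order eps |ln eps|^(n-1) / (n-1)!, with constants c^n and b^n, and b tends to c as r tends to 0. *)
theory Submission
  imports Defs
begin

section \<open>Products of independent uniform variables\<close>

text \<open>For \<open>n = 0\<close> the empty sum leaves the step function at 1, the law of the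
  empty product. At \<open>t = 0\<close> the value is 0 whatever \<open>ln (1 / 0)\<close> is; this
  is the argument that the convention \<open>a / 0 = 0\<close> produces. Negative \<open>t\<close>
  has no probabilistic meaning.\<close>

definition uniform_prod_cdf :: "nat \<Rightarrow> real \<Rightarrow> real" where
  "uniform_prod_cdf n t = (if t \<ge> 1 then 1 else t * (\<Sum>k<n. ln (1 / t) ^ k / fact k))"

lemma uniform_prod_cdf_0 [simp]: "uniform_prod_cdf n 0 = 0"
  by (simp add: uniform_prod_cdf_def)

lemma uniform_prod_cdf_ge_1: "t \<ge> 1 \<Longrightarrow> uniform_prod_cdf n t = 1"
  by (simp add: uniform_prod_cdf_def)

lemma uniform_prod_cdf_nonneg:
  assumes "0 \<le> t"
  shows "0 \<le> uniform_prod_cdf n t"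
  using assms
  by (cases "t = 0")
     (auto simp: uniform_prod_cdf_def ln_div intro!: mult_nonneg_nonneg sum_nonneg divide_nonneg_nonneg)

lemma borel_measurable_uniform_prod_cdf [measurable]:
  "uniform_prod_cdf n \<in> borel_measurable borel"
  unfolding uniform_prod_cdf_def[abs_def] by measurable

text \<open>Conditioning on one more factor: for \<open>X\<close> uniform on \<open>[0, r]\<close>,
  independent of a product \<open>U\<close> of \<open>n\<close> independent uniform variables on
  \<open>[0, 1]\<close>, the integral divided by \<open>r\<close> is the probability of
  \<open>U * X \<le> a\<close>, and \<open>X / r\<close> is just one more uniform factor. The proof
  integrates the logarithmic terms explicitly.\<close>

lemma has_integral_uniform_prod_cdf:
  assumes "0 < a" "0 < r"
  shows "((\<lambda>x. uniform_prod_cdf n (a / x)) has_integral r * uniform_prod_cdf (Suc n) (a / r)) {0..r}"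
proof -
  \<comment> \<open>Up to \<open>a\<close> the quotient \<open>a / x\<close> is at least 1 and the
    integrand is 1, except at \<open>x = 0\<close>, where \<open>a / 0 = 0\<close>.\<close>
  have flat: "((\<lambda>x. uniform_prod_cdf n (a / x)) has_integral s) {0..s}" if "0 < s" "s \<le> a" for s
  proof -
    have "((\<lambda>x. 1::real) has_integral s) {0..s}"
      using has_integral_const_real[of "1::real" 0 s] that by simp
    then show ?thesis
      by (rule has_integral_spike[of "{0}", rotated 2])
         (use that in \<open>auto simp: uniform_prod_cdf_def field_simps\<close>)
  qed
  show ?thesis
  proof (cases "r \<le> a")
    case True
    then show ?thesis
      using flat[of r] assms by (simp add: uniform_prod_cdf_ge_1)
  next
    case False
    \<comment> \<open>Integrating \<open>ln (x / a) ^ k / x\<close> raises the power by one, so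
      every exponent in the antiderivative is positive and \<open>G a = 0\<close>.\<close>
    define G where "G x = a * (\<Sum>k<n. ln (x / a) ^ Suc k / fact (Suc k))" for x
    have "((\<lambda>x. a * (\<Sum>k<n. ln (x / a) ^ k / fact k / x)) has_integral (G r - G a)) {a..r}"
    proof (rule fundamental_theorem_of_calculus)
      show "a \<le> r" using False by simp
      fix x assume x: "x \<in> {a..r}"
      have *: "((\<lambda>x. ln (x / a) ^ Suc k / fact (Suc k)) has_field_derivative
              ln (x / a) ^ k / fact k / x) (at x within {a..r})" for k
      proof -
        have "((\<lambda>x. ln (x / a)) has_field_derivative 1 / x) (at x within {a..r})"
          using x assms by (auto intro!: derivative_eq_intros)
        from DERIV_cdivide[OF DERIV_power[OF this, of "Suc k"], of "fact (Suc k)"]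
        show ?thesis by (simp add: divide_simps mult.commute del: power_Suc of_nat_Suc)
      qed
      have "(G has_field_derivative a * (\<Sum>k<n. ln (x / a) ^ k / fact k / x)) (at x within {a..r})"
        unfolding G_def by (intro DERIV_cmult DERIV_sum *)
      then show "(G has_vector_derivative a * (\<Sum>k<n. ln (x / a) ^ k / fact k / x)) (at x within {a..r})"
        by (simp add: has_real_derivative_iff_has_vector_derivative)
    qed
    \<comment> \<open>The end point \<open>a\<close> has to be left out: for \<open>n = 0\<close>
      the two integrands differ there, 1 against the empty sum.\<close>
    then have "((\<lambda>x. uniform_prod_cdf n (a / x)) has_integral (G r - G a)) {a..r}"
      by (rule has_integral_spike[of "{a}", rotated 2])
         (use assms in \<open>auto simp: uniform_prod_cdf_def field_simps sum_distrib_left\<close>)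
    moreover have "((\<lambda>x. uniform_prod_cdf n (a / x)) has_integral a) {0..a}"
      using flat[of a] assms by simp
    ultimately have "((\<lambda>x. uniform_prod_cdf n (a / x)) has_integral (a + (G r - G a))) {0..r}"
      using False assms by (intro has_integral_combine[of 0 a r]) auto
    \<comment> \<open>The flat part \<open>a\<close> is the term \<open>k = 0\<close> on the right,
      and \<open>G r\<close> supplies the terms from 1 to \<open>n\<close>.\<close>
    moreover have "a + (G r - G a) = r * uniform_prod_cdf (Suc n) (a / r)"
      using False assms
      by (simp add: G_def uniform_prod_cdf_def sum.lessThan_Suc_shift distrib_left del: sum.lessThan_Suc)
    ultimately show ?thesis by simp
  qed
qed

text \<open>The integral over \<open>[0, 1]\<close> of the previous function makes monotonicity
  inductive, so the closed form need not be differentiated.\<close>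

lemma uniform_prod_cdf_mono:
  assumes "0 < s" "s \<le> t"
  shows "uniform_prod_cdf n s \<le> uniform_prod_cdf n t"
  using assms
proof (induction n arbitrary: s t)
  case 0
  then show ?case by (simp add: uniform_prod_cdf_def)
next
  case (Suc n)
  have "uniform_prod_cdf n (s / x) \<le> uniform_prod_cdf n (t / x)" if "x \<in> {0..1}" for x
    using Suc.IH[of "s / x" "t / x"] Suc.prems that by (cases "x = 0") (auto simp: divide_right_mono)
  then show ?case
    using has_integral_le[OF has_integral_uniform_prod_cdf[of s 1 n] has_integral_uniform_prod_cdf[of t 1 n]]
      Suc.prems by simp
qed

lemma uniform_prod_cdf_le_1:
  assumes "0 \<le> t"
  shows "uniform_prod_cdf n t \<le> 1"
  using uniform_prod_cdf_mono[of t "max t 1" n] uniform_prod_cdf_ge_1[of "max t 1" n] assms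
  by (cases "t = 0") auto

text \<open>The two halves of the symmetric interval contribute equally. Values between 0 and 1 make
  the integrand Lebesgue integrable, which lets the gauge integral carry over.\<close>

lemma has_bochner_integral_uniform_prod_cdf:
  assumes "0 < a" "0 < r"
  shows "has_bochner_integral lborel (\<lambda>y. uniform_prod_cdf n (a / \<bar>y\<bar>) * indicator {-r..r} y)
     (2 * r * uniform_prod_cdf (Suc n) (a / r))"
proof -
  let ?f = "\<lambda>y. uniform_prod_cdf n (a / \<bar>y\<bar>)"
  let ?I = "r * uniform_prod_cdf (Suc n) (a / r)"
  have pos: "(?f has_integral ?I) {0..r}"
    by (rule has_integral_eq[OF _ has_integral_uniform_prod_cdf[OF assms]]) auto
  then have "((\<lambda>y. ?f (- y)) has_integral ?I) {-r..-0}"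
    by (subst has_integral_reflect_real) simp
  then have hi: "(?f has_integral (?I + ?I)) {-r..r}"
    using assms pos by (intro has_integral_combine[of "-r" 0 r]) auto
  have int: "integrable lborel (\<lambda>y. indicator {-r..r} y * ?f y)"
  proof (rule Bochner_Integration.integrable_bound)
    show "integrable lborel (indicator {-r..r} :: real \<Rightarrow> real)"
      by (intro integrable_real_indicator) (use assms in auto)
    show "AE x in lborel. norm (indicator {-r..r} x * ?f x) \<le> norm (indicator {-r..r} x :: real)"
      using assms
      by (intro always_eventually)
         (auto simp: indicator_def uniform_prod_cdf_nonneg uniform_prod_cdf_le_1)
  qed simp
  then have "set_integrable lborel {-r..r} ?f" by (simp add: set_integrable_def)
  from set_borel_integral_eq_integral(2)[OF this] int hi show ?thesis
    by (simp add: has_bochner_integral_iff set_lebesgue_integral_def integral_unique mult.commute)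
qed

text \<open>With \<open>x = - ln \<epsilon>\<close> the sum is a polynomial in \<open>x\<close> of
  degree \<open>n - 1\<close>; after division by \<open>x ^ (n - 1)\<close> only its top term
  survives. Inside the logarithm \<open>K\<close> merely shifts \<open>x\<close>, so only the
  prefactor \<open>K\<close> remains in the limit.\<close>

lemma uniform_prod_cdf_asymp:
  assumes "0 < K" "1 \<le> n"
  shows "((\<lambda>\<epsilon>. uniform_prod_cdf n (K * \<epsilon>) / (\<epsilon> * (\<bar>ln \<epsilon>\<bar> ^ (n - 1) / fact (n - 1)))) \<longlongrightarrow> K) (at_right 0)"
proof -
  have lim: "((\<lambda>x. (x - ln K) ^ k / x ^ (n - 1)) \<longlongrightarrow> (if k = n - 1 then 1 else 0)) at_top" if "k < n" for k
  proof -
    have 1: "((\<lambda>x. (x - ln K) / x) \<longlongrightarrow> 1) at_top"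
      by real_asymp
    have 2: "((\<lambda>x. inverse x ^ (n - 1 - k)) \<longlongrightarrow> 0 ^ (n - 1 - k)) (at_top :: real filter)"
      by (intro tendsto_power tendsto_inverse_0_at_top filterlim_ident)
    have "((\<lambda>x. ((x - ln K) / x) ^ k * inverse x ^ (n - 1 - k)) \<longlongrightarrow> 1 ^ k * 0 ^ (n - 1 - k)) at_top"
      by (intro tendsto_mult tendsto_power[OF 1] 2)
    moreover have "((x - ln K) / x) ^ k * inverse x ^ (n - 1 - k) = (x - ln K) ^ k / x ^ (n - 1)" for x
    proof -
      have "n - 1 = k + (n - 1 - k)" using that by simp
      then have "x ^ (n - 1) = x ^ k * x ^ (n - 1 - k)" by (metis power_add)
      then show ?thesis by (simp add: power_mult_distrib power_inverse divide_inverse)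
    qed
    \<comment> \<open>The convention \<open>0 ^ 0 = 1\<close> singles out
      \<open>k = n - 1\<close>.\<close>
    moreover have "1 ^ k * 0 ^ (n - 1 - k) = (if k = n - 1 then 1 else 0 :: real)"
      using that by (auto simp: power_0_left)
    ultimately show ?thesis by (simp only:)
  qed
  have "((\<lambda>x. K * fact (n - 1) * (\<Sum>k<n. (x - ln K) ^ k / x ^ (n - 1) / fact k)) \<longlongrightarrow>
      K * fact (n - 1) * (\<Sum>k<n. (if k = n - 1 then 1 else 0) / fact k)) at_top"
    by (intro tendsto_intros lim) auto
  moreover have "(\<Sum>k<n. (if k = n - 1 then 1 else 0) / fact k) = (1 / fact (n - 1) :: real)"
    using assms by (subst sum.remove[of _ "n - 1"]) auto
  ultimately have "((\<lambda>x. K * fact (n - 1) * (\<Sum>k<n. (x - ln K) ^ k / x ^ (n - 1) / fact k)) \<longlongrightarrow> K) at_top"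
    by simp
  moreover have "filterlim (\<lambda>\<epsilon>. - ln \<epsilon>) at_top (at_right (0::real))"
    by real_asymp
  ultimately have "((\<lambda>\<epsilon>. K * fact (n - 1) * (\<Sum>k<n. (- ln \<epsilon> - ln K) ^ k / (- ln \<epsilon>) ^ (n - 1) / fact k)) \<longlongrightarrow> K) (at_right 0)"
    by (rule filterlim_compose)
  \<comment> \<open>Below 1 the absolute value of \<open>ln \<epsilon>\<close> is
    \<open>- ln \<epsilon>\<close>; below \<open>1 / K\<close> the argument
    \<open>K * \<epsilon>\<close> falls in the logarithmic branch.\<close>
  moreover have "eventually (\<lambda>\<epsilon>. \<epsilon> \<in> {0<..<min 1 (1 / K)}) (at_right 0)"
    using assms by (intro eventually_at_right_real) auto
  then have "eventually (\<lambda>\<epsilon>. K * fact (n - 1) * (\<Sum>k<n. (- ln \<epsilon> - ln K) ^ k / (- ln \<epsilon>) ^ (n - 1) / fact k) =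
      uniform_prod_cdf n (K * \<epsilon>) / (\<epsilon> * (\<bar>ln \<epsilon>\<bar> ^ (n - 1) / fact (n - 1)))) (at_right 0)"
  proof eventually_elim
    case (elim \<epsilon>)
    then have eqs: "K * \<epsilon> < 1" "\<bar>ln \<epsilon>\<bar> = - ln \<epsilon>" "ln (1 / (K * \<epsilon>)) = - ln \<epsilon> - ln K"
      using assms by (auto simp: field_simps ln_div ln_mult)
    have cdf: "uniform_prod_cdf n (K * \<epsilon>) = K * \<epsilon> * (\<Sum>k<n. (- ln \<epsilon> - ln K) ^ k / fact k)"
      unfolding uniform_prod_cdf_def eqs(3) using eqs(1) by simp
    have sum: "(\<Sum>k<n. (- ln \<epsilon> - ln K) ^ k / (- ln \<epsilon>) ^ (n - 1) / fact k) =
        (\<Sum>k<n. (- ln \<epsilon> - ln K) ^ k / fact k) / (- ln \<epsilon>) ^ (n - 1)"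
      by (simp add: sum_divide_distrib mult.commute)
    have "K * fact (n - 1) * (s / l) = K * \<epsilon> * s / (\<epsilon> * (l / fact (n - 1)))" for s l
      using elim by simp
    then show ?case
      unfolding eqs(2) cdf sum .
  qed
  ultimately show ?thesis by (rule Lim_transform_eventually)
qed

section \<open>Products of independent Gaussian variables\<close>

abbreviation std_gaussian :: "real measure" where
  "std_gaussian \<equiv> density lborel (\<lambda>x. ennreal (std_normal_density x))"

text \<open>A concrete product space stands in for the unrelated spaces \<open>N\<close> and
  \<open>M\<close>: both laws reduce to this one function, and Tonelli applies to it coordinate by
  coordinate.\<close>

definition gaussian_prod_cdf :: "nat \<Rightarrow> real \<Rightarrow> real" where
  "gaussian_prod_cdf n \<epsilon> =
     \<P>(x in PiM {1..n} (\<lambda>_. std_gaussian). (\<Prod>j=1..n. \<bar>x j\<bar>) \<le> \<epsilon>)"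

lemma prob_space_std_gaussian: "prob_space std_gaussian"
  by (rule prob_space_normal_density) simp

lemma prob_space_PiM_std_gaussian: "prob_space (PiM I (\<lambda>_. std_gaussian))"
  by (rule prob_space_PiM[OF prob_space_std_gaussian])

lemma gaussian_prod_cdf_nonneg: "0 \<le> gaussian_prod_cdf n \<epsilon>"
  by (simp add: gaussian_prod_cdf_def)

lemma gaussian_prod_cdf_le_1: "gaussian_prod_cdf n \<epsilon> \<le> 1"
  unfolding gaussian_prod_cdf_def
  by (rule prob_space.prob_le_1[OF prob_space_PiM_std_gaussian])

lemma borel_measurable_gaussian_prod_cdf [measurable]:
  "gaussian_prod_cdf n \<in> borel_measurable borel"
proof (rule borel_measurable_mono, rule monoI)
  fix s t :: real assume "s \<le> t"
  interpret prob_space "PiM {1..n} (\<lambda>_. std_gaussian)" by (rule prob_space_PiM_std_gaussian)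
  show "gaussian_prod_cdf n s \<le> gaussian_prod_cdf n t"
    unfolding gaussian_prod_cdf_def by (rule finite_measure_mono) (use \<open>s \<le> t\<close> in auto)
qed

text \<open>The empty product is 1 in both models, so the inductions for the upper and the lower
  bound start with equality.\<close>

lemma gaussian_prod_cdf_0:
  assumes "0 < \<epsilon>"
  shows "gaussian_prod_cdf 0 \<epsilon> = uniform_prod_cdf 0 \<epsilon>"
  using assms by (simp add: gaussian_prod_cdf_def uniform_prod_cdf_def PiM_empty measure_count_space)

text \<open>Independence means that the joint law of finitely many \<open>X j\<close> is the product
  of the marginals, and the probability depends on that law alone. \<open>1 \<le> n\<close> makes
  the index set nonempty, as this characterisation of independence asks.\<close>

lemma (in prob_space) prob_prod_eq_gaussian_prod_cdf:
  assumes "indep_vars (\<lambda>_. borel) X {1..}"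
    and "\<And>j. 1 \<le> j \<Longrightarrow> distributed M lborel (X j) std_normal_density"
    and "1 \<le> n"
  shows "\<P>(\<omega> in M. (\<Prod>j=1..n. \<bar>X j \<omega>\<bar>) \<le> \<epsilon>) = gaussian_prod_cdf n \<epsilon>"
proof -
  let ?Y = "\<lambda>\<omega>. \<lambda>j\<in>{1..n}. X j \<omega>"
  have meas: "X j \<in> borel_measurable M" if "j \<in> {1..n}" for j
    using distributed_measurable[OF assms(2)] that by simp
  have "distr M borel (X j) = std_gaussian" if "j \<in> {1..n}" for j
    using distributed_distr_eq_density[OF assms(2), of j] that
    \<comment> \<open>The density hypothesis speaks of \<open>lborel\<close>, independence of
      \<open>borel\<close>; the two have the same measurable sets.\<close>
    by (metis atLeastAtMost_iff distr_cong sets_lborel)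
  then have "PiM {1..n} (\<lambda>j. distr M borel (X j)) = PiM {1..n} (\<lambda>_. std_gaussian)"
    by (intro PiM_cong) auto
  moreover have "distr M (PiM {1..n} (\<lambda>_. borel)) ?Y = PiM {1..n} (\<lambda>j. distr M borel (X j))"
    using indep_vars_subset[OF assms(1), of "{1..n}"] meas assms(3)
    by (subst indep_vars_iff_distr_eq_PiM'[symmetric]) auto
  ultimately have law: "distr M (PiM {1..n} (\<lambda>_. borel)) ?Y = PiM {1..n} (\<lambda>_. std_gaussian)"
    by simp
  have "gaussian_prod_cdf n \<epsilon> =
      \<P>(x in distr M (PiM {1..n} (\<lambda>_. borel)) ?Y. (\<Prod>j=1..n. \<bar>x j\<bar>) \<le> \<epsilon>)"
    by (simp only: gaussian_prod_cdf_def law)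
  also have "\<dots> = \<P>(\<omega> in M. (\<Prod>j=1..n. \<bar>?Y \<omega> j\<bar>) \<le> \<epsilon>)"
  proof (subst measure_distr)
    show "?Y \<in> M \<rightarrow>\<^sub>M PiM {1..n} (\<lambda>_. borel)"
      using meas by (rule measurable_restrict)
    show "{x \<in> space (distr M (PiM {1..n} (\<lambda>_. borel)) ?Y). (\<Prod>j=1..n. \<bar>x j\<bar>) \<le> \<epsilon>}
        \<in> sets (PiM {1..n} (\<lambda>_. borel))"
      unfolding space_distr by measurable
  qed (auto intro!: arg_cong[where f = prob] simp: space_PiM)
  finally show ?thesis by simp
qed

lemma integrable_gaussian_prod_cdf:
  "integrable lborel (\<lambda>y. std_normal_density y * gaussian_prod_cdf n (\<epsilon> / \<bar>y\<bar>))"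
  by (rule Bochner_Integration.integrable_bound[OF integrable_normal_density[of 1 0]])
     (auto simp: abs_mult gaussian_prod_cdf_nonneg gaussian_prod_cdf_le_1 intro!: mult_left_le)

text \<open>Tonelli with the last coordinate \<open>y\<close> outermost: once \<open>y\<close> is
  fixed, the event bounds the product of the other coordinates by \<open>\<epsilon>\<close> over the
  modulus of \<open>y\<close>.\<close>

lemma gaussian_prod_cdf_Suc:
  assumes "0 < \<epsilon>"
  shows "gaussian_prod_cdf (Suc n) \<epsilon> =
    (\<integral>y. std_normal_density y * gaussian_prod_cdf n (\<epsilon> / \<bar>y\<bar>) \<partial>lborel)"
proof -
  let ?P = "\<lambda>I. PiM I (\<lambda>_::nat. std_gaussian)"
  let ?A = "\<lambda>n \<epsilon>. {x \<in> space (?P {1..n}). (\<Prod>j=1..n. \<bar>x j\<bar>) \<le> \<epsilon>}"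
  interpret product_sigma_finite "\<lambda>_::nat. std_gaussian"
    by (intro product_sigma_finite.intro prob_space_imp_sigma_finite prob_space_std_gaussian)
  have I: "{1..Suc n} = insert (Suc n) {1..n}" by auto
  have em: "ennreal (gaussian_prod_cdf n \<epsilon>) = emeasure (?P {1..n}) (?A n \<epsilon>)" for n \<epsilon>
    unfolding gaussian_prod_cdf_def
    by (subst finite_measure.emeasure_eq_measure[OF prob_space.finite_measure[OF prob_space_PiM_std_gaussian]]) simp
  have [measurable]: "?A n \<epsilon> \<in> sets (?P {1..n})" for n \<epsilon> by measurable
  have "ennreal (gaussian_prod_cdf (Suc n) \<epsilon>) = (\<integral>\<^sup>+x. indicator (?A (Suc n) \<epsilon>) x \<partial>?P {1..Suc n})"
    unfolding em by (subst nn_integral_indicator) auto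
  also have "\<dots> = (\<integral>\<^sup>+y. (\<integral>\<^sup>+x. indicator (?A (Suc n) \<epsilon>) (x(Suc n := y)) \<partial>?P {1..n}) \<partial>std_gaussian)"
    unfolding I by (rule product_nn_integral_insert_rev) (use I in \<open>auto simp flip: I\<close>)
  also have "\<dots> = (\<integral>\<^sup>+y. ennreal (gaussian_prod_cdf n (\<epsilon> / \<bar>y\<bar>)) \<partial>std_gaussian)"
  proof (rule nn_integral_cong_AE)
    \<comment> \<open>At \<open>y = 0\<close> the product vanishes and the event is certain, whereas
      \<open>\<epsilon> / 0 = 0\<close> would demand a vanishing product of the others. This null
      set is discarded.\<close>
    have "AE y in std_gaussian. y \<noteq> 0"
      using AE_lborel_singleton[of "0::real"] by (subst AE_density) auto
    then show "AE y in std_gaussian. (\<integral>\<^sup>+x. indicator (?A (Suc n) \<epsilon>) (x(Suc n := y)) \<partial>?P {1..n}) =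
        ennreal (gaussian_prod_cdf n (\<epsilon> / \<bar>y\<bar>))"
    proof eventually_elim
      case (elim y)
      have "(\<integral>\<^sup>+x. indicator (?A (Suc n) \<epsilon>) (x(Suc n := y)) \<partial>?P {1..n}) =
          (\<integral>\<^sup>+x. indicator (?A n (\<epsilon> / \<bar>y\<bar>)) x \<partial>?P {1..n})"
      proof (rule nn_integral_cong)
        fix x assume x: "x \<in> space (?P {1..n})"
        then have "x(Suc n := y) \<in> space (?P {1..Suc n})"
          by (auto simp: space_PiM PiE_def extensional_def)
        moreover have "(\<Prod>j=1..Suc n. \<bar>(x(Suc n := y)) j\<bar>) = \<bar>y\<bar> * (\<Prod>j=1..n. \<bar>x j\<bar>)"
          by (simp add: mult.commute)
        ultimately show "indicator (?A (Suc n) \<epsilon>) (x(Suc n := y)) = (indicator (?A n (\<epsilon> / \<bar>y\<bar>)) x :: ennreal)"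
          using x elim by (auto simp: indicator_def field_simps)
      qed
      also have "\<dots> = ennreal (gaussian_prod_cdf n (\<epsilon> / \<bar>y\<bar>))"
        unfolding em by (subst nn_integral_indicator) auto
      finally show ?case .
    qed
  qed
  also have "\<dots> = (\<integral>\<^sup>+y. ennreal (std_normal_density y * gaussian_prod_cdf n (\<epsilon> / \<bar>y\<bar>)) \<partial>lborel)"
    by (subst nn_integral_density) (auto simp: ennreal_mult gaussian_prod_cdf_nonneg)
  also have "\<dots> = ennreal (\<integral>y. std_normal_density y * gaussian_prod_cdf n (\<epsilon> / \<bar>y\<bar>) \<partial>lborel)"
    by (rule nn_integral_eq_integral[OF integrable_gaussian_prod_cdf])
       (simp add: gaussian_prod_cdf_nonneg)
  finally show ?thesis
    by (subst (asm) ennreal_inj) (auto simp: gaussian_prod_cdf_nonneg intro!: integral_nonneg_AE)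
qed

section \<open>Comparison with uniform factors and the resulting asymptotics\<close>

text \<open>The bound from the induction hypothesis decreases in the modulus of \<open>y\<close>.
  Among densities bounded by \<open>c / 2\<close>, the one that packs all its mass as close to 0 as
  possible, the uniform one on \<open>[- 1 / c, 1 / c]\<close>, therefore gives the largest
  integral.\<close>

lemma gaussian_prod_cdf_upper:
  assumes "0 < \<epsilon>"
  shows "gaussian_prod_cdf n \<epsilon> \<le> uniform_prod_cdf n ((2 / sqrt (2 * pi)) ^ n * \<epsilon>)"
  using assms
proof (induction n arbitrary: \<epsilon>)
  case 0
  then show ?case by (simp add: gaussian_prod_cdf_0)
next
  case (Suc n)
  \<comment> \<open>\<open>c / 2\<close> is the maximum of the normal density, attained at 0, and
    \<open>1 / c\<close> is the half-width that gives \<open>c / 2\<close> times \<open>?D\<close>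
    total mass 1.\<close>
  define c where "c = 2 / sqrt (2 * pi)"
  define a where "a = c ^ n * \<epsilon>"
  let ?g = "\<lambda>y. uniform_prod_cdf n (a / \<bar>y\<bar>)"
  let ?\<phi> = std_normal_density
  let ?D = "indicator {-(1 / c)..1 / c} :: real \<Rightarrow> real"
  have c: "0 < c" by (simp add: c_def)
  have a: "0 < a" using c Suc.prems by (simp add: a_def)
  have dens: "?\<phi> y \<le> c / 2" for y
    by (simp add: std_normal_density_def c_def divide_right_mono)
  have int_g: "integrable lborel (\<lambda>y. ?\<phi> y * ?g y)"
    by (rule Bochner_Integration.integrable_bound[OF integrable_normal_density[of 1 0]])
       (use a in \<open>auto simp: abs_mult uniform_prod_cdf_nonneg uniform_prod_cdf_le_1 intro!: mult_left_le\<close>)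
  have gD: "has_bochner_integral lborel (\<lambda>y. ?g y * ?D y) (2 * (1 / c) * uniform_prod_cdf (Suc n) (a / (1 / c)))"
    using a c by (intro has_bochner_integral_uniform_prod_cdf) auto
  have D: "has_bochner_integral lborel ?D (2 / c)"
    using c has_bochner_integral_real_indicator[of "{-(1 / c)..1 / c}" lborel] by simp
  have "gaussian_prod_cdf (Suc n) \<epsilon> = (\<integral>y. ?\<phi> y * gaussian_prod_cdf n (\<epsilon> / \<bar>y\<bar>) \<partial>lborel)"
    by (rule gaussian_prod_cdf_Suc) fact
  also have "\<dots> \<le> (\<integral>y. ?\<phi> y * ?g y \<partial>lborel)"
  proof (rule integral_mono_AE[OF integrable_gaussian_prod_cdf int_g],
         use AE_lborel_singleton[of "0::real"] in eventually_elim)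
    case (elim y)
    then show ?case
      using Suc.IH[of "\<epsilon> / \<bar>y\<bar>"] Suc.prems by (simp add: a_def c_def mult_left_mono)
  qed
  \<comment> \<open>\<open>g y - g (1/c)\<close> and \<open>\<phi> y - c/2 * D y\<close> have opposite signs on either side of \<open>\<bar>y\<bar> = 1/c\<close>, and the second
    function integrates to \<open>0\<close>.\<close>
  also have "\<dots> \<le> (\<integral>y. c / 2 * (?g y * ?D y) + ?g (1 / c) * (?\<phi> y - c / 2 * ?D y) \<partial>lborel)"
  proof (rule integral_mono_AE[OF int_g])
    show "integrable lborel (\<lambda>y. c / 2 * (?g y * ?D y) + ?g (1 / c) * (?\<phi> y - c / 2 * ?D y))"
      using gD D by (auto simp: has_bochner_integral_iff)
    show "AE y in lborel. ?\<phi> y * ?g y \<le> c / 2 * (?g y * ?D y) + ?g (1 / c) * (?\<phi> y - c / 2 * ?D y)"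
      using AE_lborel_singleton[of "0::real"]
    proof eventually_elim
      case (elim y)
      have "(?g y - ?g (1 / c)) * (?\<phi> y - c / 2 * ?D y) \<le> 0"
      proof (cases "\<bar>y\<bar> \<le> 1 / c")
        case True
        then have "?g (1 / c) \<le> ?g y"
          using elim a c by (intro uniform_prod_cdf_mono divide_left_mono) auto
        moreover have "?D y = 1" using True by (auto simp: indicator_def)
        ultimately show ?thesis using dens[of y] by (simp add: mult_nonneg_nonpos)
      next
        case False
        then have "?g y \<le> ?g (1 / c)"
          using elim a c by (intro uniform_prod_cdf_mono divide_left_mono) auto
        moreover have "?D y = 0" using False by (auto simp: indicator_def)
        ultimately show ?thesis by (simp add: mult_nonpos_nonneg)
      qed
      moreover have "p * u \<le> q * (u * d) + v * (p - q * d)" if "(u - v) * (p - q * d) \<le> 0" for u v p q d :: real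
        using that by (simp add: algebra_simps)
      ultimately show ?case by blast
    qed
  qed
  also have "\<dots> = uniform_prod_cdf (Suc n) (c * a)"
    using gD D c by (simp add: has_bochner_integral_iff mult.commute)
  finally show ?case by (simp add: a_def c_def mult.assoc)
qed

text \<open>Only \<open>y\<close> in \<open>[- r, r]\<close> is kept in the recursion, where the
  normal density is at least \<open>b / 2\<close>. Each factor thus costs \<open>b * r\<close> and
  rescales \<open>\<epsilon>\<close> by \<open>1 / r\<close>.\<close>

lemma gaussian_prod_cdf_lower:
  assumes "0 < \<epsilon>" "0 < r"
  defines "b \<equiv> 2 / sqrt (2 * pi) * exp (- r\<^sup>2 / 2)"
  shows "(b * r) ^ n * uniform_prod_cdf n (\<epsilon> / r ^ n) \<le> gaussian_prod_cdf n \<epsilon>"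
  using assms(1)
proof (induction n arbitrary: \<epsilon>)
  case 0
  then show ?case by (simp add: gaussian_prod_cdf_0)
next
  case (Suc n)
  define a where "a = \<epsilon> / r ^ n"
  let ?g = "\<lambda>y. uniform_prod_cdf n (a / \<bar>y\<bar>)"
  let ?\<phi> = std_normal_density
  let ?D = "indicator {-r..r} :: real \<Rightarrow> real"
  have b: "0 < b" by (simp add: b_def)
  have a: "0 < a" using Suc.prems assms(2) by (simp add: a_def)
  have gD: "has_bochner_integral lborel (\<lambda>y. ?g y * ?D y) (2 * r * uniform_prod_cdf (Suc n) (a / r))"
    using a assms(2) by (rule has_bochner_integral_uniform_prod_cdf)
  \<comment> \<open>The new factor \<open>b * r\<close> is \<open>b / 2\<close> times the interval
    length \<open>2 * r\<close>.\<close>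
  have "(b * r) ^ Suc n * uniform_prod_cdf (Suc n) (\<epsilon> / r ^ Suc n) =
      (\<integral>y. b / 2 * (b * r) ^ n * (?g y * ?D y) \<partial>lborel)"
    using gD by (simp add: has_bochner_integral_iff a_def mult_ac)
  also have "\<dots> \<le> (\<integral>y. ?\<phi> y * gaussian_prod_cdf n (\<epsilon> / \<bar>y\<bar>) \<partial>lborel)"
  proof (rule integral_mono_AE[OF _ integrable_gaussian_prod_cdf])
    show "integrable lborel (\<lambda>y. b / 2 * (b * r) ^ n * (?g y * ?D y))"
      using gD by (auto simp: has_bochner_integral_iff)
    show "AE y in lborel. b / 2 * (b * r) ^ n * (?g y * ?D y) \<le> ?\<phi> y * gaussian_prod_cdf n (\<epsilon> / \<bar>y\<bar>)"
      using AE_lborel_singleton[of "0::real"]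
    proof eventually_elim
      case (elim y)
      show ?case
      proof (cases "\<bar>y\<bar> \<le> r")
        case True
        then have "y\<^sup>2 \<le> r\<^sup>2" by (simp add: abs_le_square_iff[symmetric])
        then have "b / 2 \<le> ?\<phi> y" by (simp add: b_def std_normal_density_def divide_right_mono)
        moreover have "(b * r) ^ n * ?g y \<le> gaussian_prod_cdf n (\<epsilon> / \<bar>y\<bar>)"
          using Suc.IH[of "\<epsilon> / \<bar>y\<bar>"] Suc.prems elim by (simp add: a_def mult.commute)
        ultimately have "b / 2 * ((b * r) ^ n * ?g y) \<le> ?\<phi> y * gaussian_prod_cdf n (\<epsilon> / \<bar>y\<bar>)"
          using a b assms(2)
          by (intro mult_mono) (auto simp: uniform_prod_cdf_nonneg)
        moreover have "?D y = 1" using True by (auto simp: indicator_def)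
        ultimately show ?thesis by (simp add: mult_ac)
      next
        case False
        then have "?D y = 0" by (auto simp: indicator_def)
        then show ?thesis by (simp add: gaussian_prod_cdf_nonneg)
      qed
    qed
  qed
  also have "\<dots> = gaussian_prod_cdf (Suc n) \<epsilon>"
    by (rule gaussian_prod_cdf_Suc[symmetric]) fact
  finally show ?case .
qed

text \<open>The quotient is squeezed: the upper bound has limit 1 at once, while the lower bound has
  limit \<open>exp (- r\<^sup>2 / 2) ^ n\<close> for each fixed \<open>r\<close>, which exceeds any
  given \<open>u < 1\<close> once \<open>r\<close> is small.\<close>

lemma gaussian_prod_cdf_asymp_equiv:
  assumes "1 \<le> n"
  shows "gaussian_prod_cdf n \<sim>[at_right 0]
    (\<lambda>\<epsilon>. (2 / sqrt (2 * pi)) ^ n * \<epsilon> * (\<bar>ln \<epsilon>\<bar> ^ (n - 1) / fact (n - 1)))"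
proof (rule asymp_equivI')
  define c where "c = 2 / sqrt (2 * pi)"
  let ?d = "\<lambda>\<epsilon>::real. \<epsilon> * (\<bar>ln \<epsilon>\<bar> ^ (n - 1) / fact (n - 1))"
  have c: "0 < c" by (simp add: c_def)
  have "eventually (\<lambda>\<epsilon>. \<epsilon> \<in> {0<..<1}) (at_right (0::real))"
    by (intro eventually_at_right_real) auto
  then have dpos: "eventually (\<lambda>\<epsilon>. 0 < \<epsilon> \<and> 0 < ?d \<epsilon>) (at_right 0)"
    by eventually_elim auto
  have "((\<lambda>\<epsilon>. gaussian_prod_cdf n \<epsilon> / (c ^ n * ?d \<epsilon>)) \<longlongrightarrow> 1) (at_right 0)"
  proof (rule order_tendstoI)
    fix u :: real assume "u < 1"
    have "((\<lambda>r. exp (- r\<^sup>2 / 2) ^ n) \<longlongrightarrow> exp (- 0\<^sup>2 / 2) ^ n) (at_right (0::real))"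
      by (intro tendsto_intros) auto
    then have "eventually (\<lambda>r. u < exp (- r\<^sup>2 / 2) ^ n) (at_right (0::real))"
      using \<open>u < 1\<close> by (auto dest: order_tendstoD(1))
    then have "eventually (\<lambda>r. u < exp (- r\<^sup>2 / 2) ^ n \<and> 0 < r) (at_right (0::real))"
      using eventually_at_right_less by (rule eventually_conj)
    \<comment> \<open>\<open>r\<close> depends on \<open>u\<close> alone and stays fixed while
      \<open>\<epsilon>\<close> tends to 0.\<close>
    then obtain r :: real where r: "u < exp (- r\<^sup>2 / 2) ^ n" "0 < r"
      using eventually_happens'[OF trivial_limit_at_right_real] by blast
    \<comment> \<open>This is the lower bound divided by \<open>c ^ n * ?d \<epsilon>\<close>; the
      factor \<open>c\<close> of \<open>b\<close> has cancelled, leaving the exponential.\<close>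
    let ?l = "\<lambda>\<epsilon>. (exp (- r\<^sup>2 / 2) * r) ^ n * (uniform_prod_cdf n (1 / r ^ n * \<epsilon>) / ?d \<epsilon>)"
    have "(?l \<longlongrightarrow> (exp (- r\<^sup>2 / 2) * r) ^ n * (1 / r ^ n)) (at_right 0)"
      using r assms by (intro tendsto_mult_left uniform_prod_cdf_asymp) auto
    moreover have "u < (exp (- r\<^sup>2 / 2) * r) ^ n * (1 / r ^ n)"
      using r by (simp add: power_mult_distrib)
    ultimately have "eventually (\<lambda>\<epsilon>. u < ?l \<epsilon>) (at_right 0)"
      by (rule order_tendstoD)
    then show "eventually (\<lambda>\<epsilon>. u < gaussian_prod_cdf n \<epsilon> / (c ^ n * ?d \<epsilon>)) (at_right 0)"
      using dpos
    proof eventually_elim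
      case (elim \<epsilon>)
      have cancel: "(e * r) ^ n * (h / d) * (c ^ n * d) = (c * e * r) ^ n * h" if "d \<noteq> 0" for e h d :: real
        using that by (simp add: power_mult_distrib)
      have "?d \<epsilon> \<noteq> 0"
        using elim by linarith
      then have "?l \<epsilon> * (c ^ n * ?d \<epsilon>) =
          (c * exp (- r\<^sup>2 / 2) * r) ^ n * uniform_prod_cdf n (1 / r ^ n * \<epsilon>)"
        by (rule cancel)
      also have "\<dots> \<le> gaussian_prod_cdf n \<epsilon>"
        using gaussian_prod_cdf_lower[of \<epsilon> r n] elim r by (simp add: c_def)
      finally have "?l \<epsilon> \<le> gaussian_prod_cdf n \<epsilon> / (c ^ n * ?d \<epsilon>)"
        by (rule pos_le_divide_eq[OF mult_pos_pos[OF zero_less_power[OF c]], THEN iffD2, rotated])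
           (use elim in blast)
      with elim show ?case by linarith
    qed
  next
    fix u :: real assume "1 < u"
    let ?l = "\<lambda>\<epsilon>. uniform_prod_cdf n (c ^ n * \<epsilon>) / ?d \<epsilon>"
    have "(?l \<longlongrightarrow> c ^ n) (at_right 0)"
      using c assms by (intro uniform_prod_cdf_asymp) auto
    moreover have "c ^ n < c ^ n * u" using c \<open>1 < u\<close> by simp
    ultimately have "eventually (\<lambda>\<epsilon>. ?l \<epsilon> < c ^ n * u) (at_right 0)"
      by (rule order_tendstoD)
    then show "eventually (\<lambda>\<epsilon>. gaussian_prod_cdf n \<epsilon> / (c ^ n * ?d \<epsilon>) < u) (at_right 0)"
      using dpos
    proof eventually_elim
      case (elim \<epsilon>)
      have "uniform_prod_cdf n (c ^ n * \<epsilon>) < c ^ n * u * ?d \<epsilon>"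
        using elim by (subst (asm) pos_divide_less_eq) auto
      moreover have "gaussian_prod_cdf n \<epsilon> \<le> uniform_prod_cdf n (c ^ n * \<epsilon>)"
        unfolding c_def using elim by (intro gaussian_prod_cdf_upper) blast
      ultimately have "gaussian_prod_cdf n \<epsilon> < u * (c ^ n * ?d \<epsilon>)"
        by (simp only: mult_ac)
      then show ?case
        by (rule pos_divide_less_eq[OF mult_pos_pos[OF zero_less_power[OF c]], THEN iffD2, rotated])
           (use elim in blast)
    qed
  qed
  then show "((\<lambda>\<epsilon>. gaussian_prod_cdf n \<epsilon> /
      ((2 / sqrt (2 * pi)) ^ n * \<epsilon> * (\<bar>ln \<epsilon>\<bar> ^ (n - 1) / fact (n - 1)))) \<longlongrightarrow> 1) (at_right 0)"
    by (simp only: c_def mult.assoc)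
qed

section \<open>Diagonal Gaussian arrays\<close>

text \<open>Joint Gaussianity, applied to a single index with coefficient 1, makes each entry
  Gaussian; the vanishing mean then forces \<open>m = 0\<close> in the degenerate and in the normal
  case alike.\<close>

lemma centered_gaussian_array_cases:
  assumes "prob_space M" "centered_gaussian_array M \<tau>" "1 \<le> i" "1 \<le> j"
  shows "\<tau> i j \<in> borel_measurable M"
    and "(AE \<omega> in M. \<tau> i j \<omega> = 0) \<or> (\<exists>s>0. distributed M lborel (\<tau> i j) (normal_density 0 s))"
proof -
  interpret prob_space M by fact
  have "gaussian_rv M (\<lambda>\<omega>. \<Sum>p\<in>{(i, j)}. 1 * (case p of (i, j) \<Rightarrow> \<tau> i j) \<omega>)"
    using assms(2-4) unfolding centered_gaussian_array_def jointly_gaussian_def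
    by (auto dest!: spec[of _ "{(i, j)}"] spec[of _ "\<lambda>_. 1"])
  then have g: "gaussian_rv M (\<tau> i j)" by simp
  then show meas: "\<tau> i j \<in> borel_measurable M" by (simp add: gaussian_rv_def)
  have zero: "integral\<^sup>L M (\<tau> i j) = 0"
    using assms(2-4) by (simp add: centered_gaussian_array_def)
  from g obtain m where "(AE \<omega> in M. \<tau> i j \<omega> = m) \<or>
      (\<exists>s>0. distributed M lborel (\<tau> i j) (normal_density m s))"
    by (auto simp: gaussian_rv_def)
  then show "(AE \<omega> in M. \<tau> i j \<omega> = 0) \<or> (\<exists>s>0. distributed M lborel (\<tau> i j) (normal_density 0 s))"
  proof (elim disjE exE conjE)
    assume m: "AE \<omega> in M. \<tau> i j \<omega> = m"
    then have "integral\<^sup>L M (\<tau> i j) = (\<integral>\<omega>. m \<partial>M)"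
      using meas by (intro integral_cong_AE) auto
    with zero m show ?thesis by (simp add: prob_space)
  next
    fix s :: real assume s: "s > 0" "distributed M lborel (\<tau> i j) (normal_density m s)"
    then have "m = 0" using normal_distributed_expectation[of s "\<tau> i j" m] zero by simp
    with s show ?thesis by auto
  qed
qed

text \<open>The powers 1 and 2 serve below: first moments to factor expectations of independent
  entries, squares to dominate mixed products.\<close>

lemma centered_gaussian_array_integrable:
  assumes "prob_space M" "centered_gaussian_array M \<tau>" "1 \<le> i" "1 \<le> j"
  shows "integrable M (\<lambda>\<omega>. \<tau> i j \<omega> ^ k)"
  using centered_gaussian_array_cases(2)[OF assms]
proof (elim disjE exE conjE)
  note [measurable] = centered_gaussian_array_cases(1)[OF assms]
  interpret prob_space M by fact
  assume "AE \<omega> in M. \<tau> i j \<omega> = 0"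
  then have "AE \<omega> in M. \<tau> i j \<omega> ^ k = 0 ^ k" by eventually_elim simp
  then have "integrable M (\<lambda>\<omega>. \<tau> i j \<omega> ^ k) \<longleftrightarrow> integrable M (\<lambda>\<omega>. (0::real) ^ k)"
    by (intro integrable_cong_AE) auto
  then show ?thesis by simp
next
  fix s :: real assume s: "s > 0" "distributed M lborel (\<tau> i j) (normal_density 0 s)"
  then have "integrable lborel (\<lambda>x. normal_density 0 s x * x ^ k) \<longleftrightarrow> integrable M (\<lambda>\<omega>. \<tau> i j \<omega> ^ k)"
    by (intro distributed_integrable) auto
  then show ?thesis using integrable_normal_moment[of s 0 k] s by simp
qed

text \<open>\<open>\<tau> k k\<close> is orthogonal to every admissible \<open>\<tau> i j\<close>:
  off the diagonal these vanish almost everywhere, and on it they are independent of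
  \<open>\<tau> k k\<close> while all means are 0. By Pythagoras no combination beats the zero
  family.\<close>

lemma innovation_variance_diagonal:
  assumes "prob_space M" "centered_gaussian_array M \<tau>"
    and diag: "\<And>i j. 1 \<le> i \<Longrightarrow> 1 \<le> j \<Longrightarrow> i \<noteq> j \<Longrightarrow> AE \<omega> in M. \<tau> i j \<omega> = 0"
    and indep: "prob_space.indep_vars M (\<lambda>_. borel) (\<lambda>j. \<tau> j j) {1..}"
    and "1 \<le> k"
  shows "innovation_variance M \<tau> k = (\<integral>\<omega>. (\<tau> k k \<omega>)\<^sup>2 \<partial>M)"
proof -
  interpret prob_space M by fact
  note meas = centered_gaussian_array_cases(1)[OF assms(1,2)]
  note int = centered_gaussian_array_integrable[OF assms(1,2)]
  have prod_int: "integrable M (\<lambda>\<omega>. \<tau> i j \<omega> * \<tau> i' j' \<omega>)"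
    if "1 \<le> i" "1 \<le> j" "1 \<le> i'" "1 \<le> j'" for i j i' j'
  proof (rule Bochner_Integration.integrable_bound)
    show "integrable M (\<lambda>\<omega>. (\<tau> i j \<omega>)\<^sup>2 + (\<tau> i' j' \<omega>)\<^sup>2)"
      using that by (intro Bochner_Integration.integrable_add int) auto
    show "(\<lambda>\<omega>. \<tau> i j \<omega> * \<tau> i' j' \<omega>) \<in> borel_measurable M"
      using that by (intro borel_measurable_times meas) auto
    have "\<bar>x * y\<bar> \<le> x\<^sup>2 + y\<^sup>2" for x y :: real
      using zero_le_power2[of "\<bar>x\<bar> - \<bar>y\<bar>"] sum_power2_ge_zero[of x y]
      unfolding power2_diff power2_abs abs_mult by linarith
    then show "AE \<omega> in M. norm (\<tau> i j \<omega> * \<tau> i' j' \<omega>) \<le> norm ((\<tau> i j \<omega>)\<^sup>2 + (\<tau> i' j' \<omega>)\<^sup>2)"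
      by simp
  qed
  have orth: "(\<integral>\<omega>. \<tau> k k \<omega> * \<tau> i j \<omega> \<partial>M) = 0" if "1 \<le> i" "1 \<le> j" "min i j < k" for i j
  proof (cases "i = j")
    case True
    then have "i \<noteq> k" using that by auto
    have "(\<integral>\<omega>. (\<Prod>j\<in>{i, k}. \<tau> j j \<omega>) \<partial>M) = (\<Prod>j\<in>{i, k}. \<integral>\<omega>. \<tau> j j \<omega> \<partial>M)"
      using that assms(5) int[of _ _ 1]
      by (intro indep_vars_lebesgue_integral indep_vars_subset[OF indep]) auto
    moreover have "(\<integral>\<omega>. \<tau> k k \<omega> \<partial>M) = 0"
      using assms(2,5) by (simp add: centered_gaussian_array_def)
    ultimately show ?thesis using \<open>i \<noteq> k\<close> True by (simp add: mult.commute)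
  next
    case False
    with diag[of i j] that have "AE \<omega> in M. \<tau> k k \<omega> * \<tau> i j \<omega> = 0" by auto
    then show ?thesis by (rule integral_eq_zero_AE)
  qed
  have le: "(\<integral>\<omega>. (\<tau> k k \<omega>)\<^sup>2 \<partial>M) \<le>
      (\<integral>\<omega>. (\<tau> k k \<omega> - (\<Sum>(i, j) | a (i, j) \<noteq> 0. a (i, j) * \<tau> i j \<omega>))\<^sup>2 \<partial>M)"
    if a: "a \<in> coeff_families k" for a
  proof -
    define F where "F = {p. a p \<noteq> 0}"
    have F: "finite F" "\<And>p. p \<in> F \<Longrightarrow> 1 \<le> fst p \<and> 1 \<le> snd p \<and> min (fst p) (snd p) < k"
      using a by (auto simp: coeff_families_def F_def)
    let ?\<tau> = "\<lambda>p. \<tau> (fst p) (snd p)"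
    define S where "S \<omega> = (\<Sum>p\<in>F. a p * ?\<tau> p \<omega>)" for \<omega>
    have S: "(\<Sum>(i, j) | a (i, j) \<noteq> 0. a (i, j) * \<tau> i j \<omega>) = S \<omega>" for \<omega>
      unfolding S_def F_def by (intro sum.cong) auto
    have TS_int: "integrable M (\<lambda>\<omega>. a p * (\<tau> k k \<omega> * ?\<tau> p \<omega>))" if "p \<in> F" for p
      using F(2)[OF that] assms(5) by (intro integrable_mult_right prod_int) auto
    have TS: "\<tau> k k \<omega> * S \<omega> = (\<Sum>p\<in>F. a p * (\<tau> k k \<omega> * ?\<tau> p \<omega>))" for \<omega>
      by (simp add: S_def sum_distrib_left mult_ac)
    \<comment> \<open>The expansion serves integrability only; of the integral of the square just
      nonnegativity is used.\<close>
    have SS: "(S \<omega>)\<^sup>2 = (\<Sum>p\<in>F. \<Sum>q\<in>F. (a p * a q) * (?\<tau> p \<omega> * ?\<tau> q \<omega>))" for \<omega>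
      by (simp add: S_def power2_eq_square sum_product mult_ac)
    have i1: "integrable M (\<lambda>\<omega>. (\<tau> k k \<omega>)\<^sup>2)" using assms(5) by (intro int) auto
    have i2: "integrable M (\<lambda>\<omega>. \<tau> k k \<omega> * S \<omega>)"
      unfolding TS using TS_int by (intro Bochner_Integration.integrable_sum)
    have i3: "integrable M (\<lambda>\<omega>. (S \<omega>)\<^sup>2)"
      unfolding SS using F(2)
      by (intro Bochner_Integration.integrable_sum integrable_mult_right prod_int) auto
    have "(\<integral>\<omega>. \<tau> k k \<omega> * S \<omega> \<partial>M) = (\<Sum>p\<in>F. \<integral>\<omega>. a p * (\<tau> k k \<omega> * ?\<tau> p \<omega>) \<partial>M)"
      unfolding TS by (rule Bochner_Integration.integral_sum[OF TS_int])
    also have "\<dots> = 0"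
    proof (rule sum.neutral, rule ballI)
      fix p assume "p \<in> F"
      then show "(\<integral>\<omega>. a p * (\<tau> k k \<omega> * ?\<tau> p \<omega>) \<partial>M) = 0"
        using F(2) orth[of "fst p" "snd p"] by simp
    qed
    finally have "(\<integral>\<omega>. \<tau> k k \<omega> * S \<omega> \<partial>M) = 0" .
    moreover have "(\<tau> k k \<omega> - S \<omega>)\<^sup>2 = (\<tau> k k \<omega>)\<^sup>2 - 2 * (\<tau> k k \<omega> * S \<omega>) + (S \<omega>)\<^sup>2" for \<omega>
      by (simp add: power2_diff)
    ultimately have "(\<integral>\<omega>. (\<tau> k k \<omega> - S \<omega>)\<^sup>2 \<partial>M) = (\<integral>\<omega>. (\<tau> k k \<omega>)\<^sup>2 \<partial>M) + (\<integral>\<omega>. (S \<omega>)\<^sup>2 \<partial>M)"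
      using i1 i2 i3 by simp
    moreover have "0 \<le> (\<integral>\<omega>. (S \<omega>)\<^sup>2 \<partial>M)" by simp
    ultimately show ?thesis unfolding S by linarith
  qed
  \<comment> \<open>The zero family attains the infimum, and it also witnesses that the range of the
    infimum is nonempty.\<close>
  have zero: "(\<lambda>_. 0) \<in> coeff_families k" by (simp add: coeff_families_def)
  show ?thesis
    unfolding innovation_variance_def
  proof (rule antisym)
    show "(INF a\<in>coeff_families k. \<integral>\<omega>. (\<tau> k k \<omega> - (\<Sum>(i, j) | a (i, j) \<noteq> 0. a (i, j) * \<tau> i j \<omega>))\<^sup>2 \<partial>M)
        \<le> (\<integral>\<omega>. (\<tau> k k \<omega>)\<^sup>2 \<partial>M)"
      by (rule cINF_lower2[OF _ zero]) (auto intro!: bdd_belowI2[of _ 0])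
    show "(\<integral>\<omega>. (\<tau> k k \<omega>)\<^sup>2 \<partial>M) \<le>
        (INF a\<in>coeff_families k. \<integral>\<omega>. (\<tau> k k \<omega> - (\<Sum>(i, j) | a (i, j) \<noteq> 0. a (i, j) * \<tau> i j \<omega>))\<^sup>2 \<partial>M)"
      by (rule cINF_greatest) (use zero le in auto)
  qed
qed

text \<open>Second moment 1 excludes the degenerate case and fixes the standard deviation.\<close>

lemma centered_gaussian_array_std_normal:
  assumes "prob_space M" "centered_gaussian_array M \<tau>" "1 \<le> i" "1 \<le> j"
    and "(\<integral>\<omega>. (\<tau> i j \<omega>)\<^sup>2 \<partial>M) = 1"
  shows "distributed M lborel (\<tau> i j) std_normal_density"
  using centered_gaussian_array_cases(2)[OF assms(1-4)]
proof (elim disjE exE conjE)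
  assume "AE \<omega> in M. \<tau> i j \<omega> = 0"
  then have "(\<integral>\<omega>. (\<tau> i j \<omega>)\<^sup>2 \<partial>M) = 0"
    by (intro integral_eq_zero_AE) auto
  with assms(5) show ?thesis by simp
next
  interpret prob_space M by fact
  fix s :: real assume s: "s > 0" "distributed M lborel (\<tau> i j) (normal_density 0 s)"
  have "integral\<^sup>L M (\<tau> i j) = 0" using assms(2-4) by (simp add: centered_gaussian_array_def)
  with normal_distributed_variance[OF s] assms(5) have "s\<^sup>2 = 1" by simp
  with s(1) have "s = 1" by (simp add: power2_eq_1_iff)
  with s show ?thesis by simp
qed

section \<open>Determinants of diagonal arrays\<close>

text \<open>The determinant will agree with the diagonal product only almost everywhere, and
  \<open>M\<close> need not be complete, so measurability is taken from the Leibniz formula.\<close>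

lemma borel_measurable_corner_det:
  assumes "\<And>i j. 1 \<le> i \<Longrightarrow> 1 \<le> j \<Longrightarrow> \<tau> i j \<in> borel_measurable M"
  shows "corner_det \<tau> n \<in> borel_measurable M"
proof -
  let ?A = "\<lambda>\<omega>. Matrix.mat n n (\<lambda>(i, j). \<tau> (Suc i) (Suc j) \<omega>)"
  have "corner_det \<tau> n = (\<lambda>\<omega>. \<Sum>p | p permutes {0..<n}. signof p * (\<Prod>i=0..<n. \<tau> (Suc i) (Suc (p i)) \<omega>))"
    unfolding corner_det_def[abs_def]
    by (subst det_def'[of _ n])
       (auto intro!: ext sum.cong arg_cong2[where f = "(*)"] prod.cong dest: permutes_in_image)
  then show ?thesis
    using assms by (auto intro!: borel_measurable_sum borel_measurable_times borel_measurable_prod)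
qed

text \<open>There are countably many index pairs, so one null set serves them all; off it the matrix
  is diagonal, in particular upper triangular.\<close>

lemma AE_corner_det_diagonal:
  assumes diag: "\<And>i j. 1 \<le> i \<Longrightarrow> 1 \<le> j \<Longrightarrow> i \<noteq> j \<Longrightarrow> AE \<omega> in M. \<tau> i j \<omega> = 0"
  shows "AE \<omega> in M. corner_det \<tau> n \<omega> = (\<Prod>j=1..n. \<tau> j j \<omega>)"
proof -
  have "AE \<omega> in M. \<forall>i\<in>{1..}. \<forall>j\<in>{1..}. i \<noteq> j \<longrightarrow> \<tau> i j \<omega> = 0"
    using diag by (auto simp: AE_ball_countable)
  then show ?thesis
  proof eventually_elim
    case (elim \<omega>)
    let ?A = "Matrix.mat n n (\<lambda>(i, j). \<tau> (Suc i) (Suc j) \<omega>)"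
    have "upper_triangular ?A" using elim by auto
    then have "det ?A = prod_list (diag_mat ?A)" by (rule det_upper_triangular[of _ n]) auto
    also have "\<dots> = (\<Prod>i=0..<n. \<tau> (Suc i) (Suc i) \<omega>)" by (simp add: prod_list_diag_prod)
    also have "\<dots> = (\<Prod>j=1..n. \<tau> j j \<omega>)"
      by (simp add: prod.atLeast1_atMost_eq atLeast0LessThan)
    finally show ?case by (simp add: corner_det_def)
  qed
qed

theorem mainTheorem2:
  fixes N :: "'b measure" and X :: "nat \<Rightarrow> 'b \<Rightarrow> real"
  assumes "prob_space N"
    and "prob_space.indep_vars N (\<lambda>_. borel) X {1..}"
    and "\<And>j. j \<ge> 1 \<Longrightarrow> distributed N lborel (X j) std_normal_density"
  shows "(\<forall>(M :: 'a measure) (\<tau> :: nat \<Rightarrow> nat \<Rightarrow> 'a \<Rightarrow> real).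
            prob_space M \<longrightarrow>
            centered_gaussian_array M \<tau> \<longrightarrow>
            (\<forall>k\<ge>1. innovation_variance M \<tau> k = 1) \<longrightarrow>
            (\<forall>i\<ge>1. \<forall>j\<ge>1. i \<noteq> j \<longrightarrow> (AE \<omega> in M. \<tau> i j \<omega> = 0)) \<longrightarrow>
            prob_space.indep_vars M (\<lambda>_. borel) (\<lambda>j. \<tau> j j) {1..} \<longrightarrow>
            (\<forall>n\<ge>1. \<forall>\<epsilon>>0.
               \<P>(\<omega> in M. \<bar>corner_det \<tau> n \<omega>\<bar> \<le> \<epsilon>) =
               \<P>(\<omega> in N. (\<Prod>j=1..n. \<bar>X j \<omega>\<bar>) \<le> \<epsilon>)))
       \<and> (\<forall>n\<ge>1.
            (\<lambda>\<epsilon>. \<P>(\<omega> in N. (\<Prod>j=1..n. \<bar>X j \<omega>\<bar>) \<le> \<epsilon>))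
              \<sim>[at_right 0]
            (\<lambda>\<epsilon>::real. (2 / sqrt (2 * pi)) ^ n * \<epsilon> * (\<bar>ln \<epsilon>\<bar> ^ (n - 1) / fact (n - 1))))"
proof -
  interpret N: prob_space N by fact
  \<comment> \<open>With both probabilities expressed by \<open>gaussian_prod_cdf\<close>, the
    equality claim is transitivity and the asymptotic claim concerns this function alone.\<close>
  have cdf_N: "\<P>(\<omega> in N. (\<Prod>j=1..n. \<bar>X j \<omega>\<bar>) \<le> \<epsilon>) = gaussian_prod_cdf n \<epsilon>" if "1 \<le> n" for n \<epsilon>
    using N.prob_prod_eq_gaussian_prod_cdf[OF assms(2,3) that] .
  have det_law: "\<P>(\<omega> in M. \<bar>corner_det \<tau> n \<omega>\<bar> \<le> \<epsilon>) = gaussian_prod_cdf n \<epsilon>"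
    if M: "prob_space M" "centered_gaussian_array M \<tau>"
      and innov: "\<forall>k\<ge>1. innovation_variance M \<tau> k = 1"
      and diag: "\<forall>i\<ge>1. \<forall>j\<ge>1. i \<noteq> j \<longrightarrow> (AE \<omega> in M. \<tau> i j \<omega> = 0)"
      and indep: "prob_space.indep_vars M (\<lambda>_. borel) (\<lambda>j. \<tau> j j) {1..}"
      and n: "1 \<le> n"
    for M :: "'a measure" and \<tau> n \<epsilon>
  proof -
    interpret M: prob_space M by fact
    note [measurable] = centered_gaussian_array_cases(1)[OF M]
      borel_measurable_corner_det[of \<tau> M, OF centered_gaussian_array_cases(1)[OF M]]
    have "distributed M lborel (\<tau> j j) std_normal_density" if "1 \<le> j" for j
      using innovation_variance_diagonal[OF M _ indep that] innov diag that
      by (intro centered_gaussian_array_std_normal[OF M]) auto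
    from M.prob_prod_eq_gaussian_prod_cdf[OF indep this n]
    have "\<P>(\<omega> in M. (\<Prod>j=1..n. \<bar>\<tau> j j \<omega>\<bar>) \<le> \<epsilon>) = gaussian_prod_cdf n \<epsilon>" .
    moreover have "\<P>(\<omega> in M. \<bar>corner_det \<tau> n \<omega>\<bar> \<le> \<epsilon>) = \<P>(\<omega> in M. (\<Prod>j=1..n. \<bar>\<tau> j j \<omega>\<bar>) \<le> \<epsilon>)"
    proof (rule M.prob_eq_AE)
      have "AE \<omega> in M. corner_det \<tau> n \<omega> = (\<Prod>j=1..n. \<tau> j j \<omega>)"
        using diag by (intro AE_corner_det_diagonal) auto
      then show "AE \<omega> in M. \<bar>corner_det \<tau> n \<omega>\<bar> \<le> \<epsilon> \<longleftrightarrow> (\<Prod>j=1..n. \<bar>\<tau> j j \<omega>\<bar>) \<le> \<epsilon>"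
        by eventually_elim (simp add: abs_prod)
      have [measurable]: "(\<lambda>\<omega>. \<Prod>j=1..n. \<bar>\<tau> j j \<omega>\<bar>) \<in> borel_measurable M"
        by (intro borel_measurable_prod borel_measurable_abs centered_gaussian_array_cases(1)[OF M]) auto
      show "{\<omega> \<in> space M. (\<Prod>j=1..n. \<bar>\<tau> j j \<omega>\<bar>) \<le> \<epsilon>} \<in> M.events" by measurable
      show "{\<omega> \<in> space M. \<bar>corner_det \<tau> n \<omega>\<bar> \<le> \<epsilon>} \<in> M.events" by measurable
    qed
    ultimately show ?thesis by simp
  qed
  have asymp: "(\<lambda>\<epsilon>. \<P>(\<omega> in N. (\<Prod>j=1..n. \<bar>X j \<omega>\<bar>) \<le> \<epsilon>)) \<sim>[at_right 0]
      (\<lambda>\<epsilon>::real. (2 / sqrt (2 * pi)) ^ n * \<epsilon> * (\<bar>ln \<epsilon>\<bar> ^ (n - 1) / fact (n - 1)))"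
    if "1 \<le> n" for n
    unfolding cdf_N[OF that] by (rule gaussian_prod_cdf_asymp_equiv[OF that])
  show ?thesis
    by (intro conjI allI impI) (subst cdf_N, assumption, rule det_law, assumption+, rule asymp, assumption)
qed

end
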